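(* Let $(\Omega,\mathcal H,\mu)$ be a complete finite measure space and let $(X,\eta)$ be a net convergence space, with $X$ a topological vector space, whose continuous dual $\mathcal L(X)$ is nonempty and separates the points of $X$. Let $f:\Omega\to X$ be scalarly integrable, where $X$ is equipped with its weak net convergence structure $\eta_w$. Suppose the integration nets are such that, for measurable real functions $g:\Omega\to\mathbb R$, if $g$ is Lebesgue integrable with respect to $\mu$ then its net Riemann integral exists and coincides with its Lebesgue integral (on each $A\in\mathcal H$), and conversely. Then, the net Riemann integral of $f$ being taken in $(X,\eta_w)$: (i) $f$ is Pettis integrable if and only if $\int_A f\,d\mu\in X$ for each $A\in\mathcal H$ (i.e. the net Riemann integral $\int_A f\,d\mu$ exists as an element of $X$); (ii) $f$ is Pettis integrable on every $A\in\mathcal H$ if and only if $f$ is net Riemann integrable (on every $A\in\mathcal H$); (iii) $\int_A^{(P)}f\,d\mu=\int_A f\,d\mu$ for each $A\in\mathcal H$, where $\int^{(P)}$ denotes the Pettis integral.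
   Context: A net convergence structure $\eta$ on a set $V$ assigns to each $v\in V$ a class $\eta(v)$ of nets in $V$ (those "converging to $v$") such that: (i) constant nets equal to $v$ converge to $v$; (ii) every quasi-subnet of a net converging to $v$ converges to $v$, where $(y_j)_{j\in J}$ is a quasi-subnet of $(x_i)_{i\in I}$ if for every $i_0\in I$ there is $j_0\in J$ with $\{y_j:j\ge j_0\}\subseteq\{x_i:i\ge i_0\}$; (iii) if $(x_i)_{i\in I}$ and $(y_i)_{i\in I}$ converge to $v$ and $z_i\in\{x_i,y_i\}$ for all $i$, then $(z_i)$ converges to $v$. Standing assumptions: vector spaces are real; net convergence structures are Hausdorff (unique limits); addition and multiplication by each fixed real number are continuous (preserve convergence of nets). $\mathcal L(X)$ is the set of linear functionals $\psi:X\to\mathbb R$ that are continuous, i.e. $x_i\to x$ in $\eta$ implies $\psi(x_i)\to\psi(x)$ in $\mathbb R$. It separates points if $\bigcap\{\ker\psi:\psi\in\mathcal L(X)\}=\{0\}$. In the weak structure $\eta_w$, $x_i\to x$ iff $\psi(x_i)\to\psi(x)$ for every $\psi\in\mathcal L(X)$. $f:\Omega\to X$ is weakly measurable if $\psi\circ f$ is Borel measurable for every $\psi\in\mathcal L(X)$; it is scalarly integrable if it is weakly measurable and each $\psi\circ f$ is Lebesgue integrable with respect to $\mu$. A scalarly integrable $f$ is Pettis integrable on $A\in\mathcal H$ with Pettis integral $\int_A^{(P)}f\,d\mu=x_A\in X$ if $\psi(x_A)=\int_A\psi(f)\,d\mu$ (Lebesgue) for every $\psi\in\mathcal L(X)$;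 $f$ is Pettis integrable if it is so on every $A\in\mathcal H$. Net Riemann integral: for each $A\in\mathcal H$ a net $\{(\sigma_\gamma,\tau_\gamma)\}_{\gamma\in\Gamma(A)}$ is fixed, where $\Gamma(A)$ is a directed set and $\sigma_\gamma=\{\sigma_{\gamma_i}\}_{i\in I_\gamma}$, $\tau_\gamma=\{\tau_{\gamma_i}\}_{i\in I_\gamma}$ are finite families in $\mathcal H$ and in $\Omega$ respectively. For $h:\Omega\to V$ ($V$ a vector space with a net convergence structure), $\int_A h\,d\mu:=\lim_{\gamma\in\Gamma(A)}\sum_{i\in I_\gamma}h(\tau_{\gamma_i})\mu(\sigma_{\gamma_i})$ when the limit exists. For real functions the limit is in the Euclidean topology; for $f$ it is in $(X,\eta_w)$. $h$ is net Riemann integrable if this limit exists for every $A\in\mathcal H$. *)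

theory Defs
  imports "HOL-Analysis.Analysis"
begin

text \<open>
  A directed set is given by its order relation \<open>r\<close>; its underlying set is \<open>Field r\<close>, and
  \<open>(i, j) \<in> r\<close> reads \<open>i \<le> j\<close>.  Antisymmetry is not required.
\<close>

definition directed_set :: "'i rel \<Rightarrow> bool" where
  "directed_set r \<longleftrightarrow> Preorder r \<and> Field r \<noteq> {} \<and>
     (\<forall>i\<in>Field r. \<forall>j\<in>Field r. \<exists>k. (i, k) \<in> r \<and> (j, k) \<in> r)"

text \<open>
  Only the values of \<open>net_val\<close> on \<open>Field (net_order N)\<close> matter.  The map function \<open>map_net\<close>
  generated by the datatype package sends a net \<open>(x\<^sub>i)\<close> to \<open>(g x\<^sub>i)\<close>.
\<close>

datatype ('i, 'v) net = Net (net_order: "'i rel") (net_val: "'i \<Rightarrow> 'v")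

definition is_net :: "('i, 'v) net \<Rightarrow> bool" where
  "is_net N \<longleftrightarrow> directed_set (net_order N)"

definition net_tail :: "('i, 'v) net \<Rightarrow> 'i \<Rightarrow> 'v set" where
  "net_tail N i = net_val N ` (net_order N `` {i})"

definition quasi_subnet :: "('j, 'v) net \<Rightarrow> ('i, 'v) net \<Rightarrow> bool" where
  "quasi_subnet M N \<longleftrightarrow>
     (\<forall>i\<^sub>0\<in>Field (net_order N). \<exists>j\<^sub>0\<in>Field (net_order M). net_tail M j\<^sub>0 \<subseteq> net_tail N i\<^sub>0)"

text \<open>
  \<open>\<eta> v\<close> is the set of nets converging to \<open>v\<close>.  The class of all nets in \<open>'v\<close> is not available in
  HOL, so a structure speaks about the nets whose index sets lie in a type \<open>'i\<close>; this type is an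
  arbitrary parameter.  By \<open>quasi_equivalent_canonical_net\<close> below, the type \<open>'v set \<times> 'v\<close> is
  already large enough to represent every net up to quasi-subnets in both directions.
\<close>

type_synonym ('i, 'v) net_structure = "'v \<Rightarrow> ('i, 'v) net set"

locale net_convergence_structure =
  fixes \<eta> :: "('i, 'v) net_structure"
  assumes nets: "N \<in> \<eta> v \<Longrightarrow> is_net N"
    and constant_net: "directed_set r \<Longrightarrow> (\<And>i. i \<in> Field r \<Longrightarrow> x i = v) \<Longrightarrow> Net r x \<in> \<eta> v"
    and quasi_subnet: "N \<in> \<eta> v \<Longrightarrow> is_net M \<Longrightarrow> quasi_subnet M N \<Longrightarrow> M \<in> \<eta> v"
    and mixing: "Net r x \<in> \<eta> v \<Longrightarrow> Net r y \<in> \<eta> v \<Longrightarrow>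
      (\<And>i. i \<in> Field r \<Longrightarrow> z i \<in> {x i, y i}) \<Longrightarrow> Net r z \<in> \<eta> v"

text \<open>
  Topological vector spaces in the sense of net convergence: Hausdorff, with continuous addition
  and continuous multiplication by each fixed real number.
\<close>

locale net_vector_space = net_convergence_structure \<eta>
  for \<eta> :: "('i, 'v::real_vector) net_structure" +
  assumes hausdorff: "N \<in> \<eta> u \<Longrightarrow> N \<in> \<eta> v \<Longrightarrow> u = v"
    and add: "Net r x \<in> \<eta> u \<Longrightarrow> Net r y \<in> \<eta> v \<Longrightarrow> Net r (\<lambda>i. x i + y i) \<in> \<eta> (u + v)"
    and scale: "Net r x \<in> \<eta> u \<Longrightarrow> Net r (\<lambda>i. c *\<^sub>R x i) \<in> \<eta> (c *\<^sub>R u)"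

definition tail_filter :: "'i rel \<Rightarrow> 'i filter" where
  "tail_filter r = (INF i\<in>Field r. principal (r `` {i}))"

lemma eventually_tail_filter:
  assumes "directed_set r"
  shows "eventually P (tail_filter r) \<longleftrightarrow> (\<exists>i\<^sub>0\<in>Field r. \<forall>i. (i\<^sub>0, i) \<in> r \<longrightarrow> P i)"
proof -
  have "\<exists>k\<in>Field r. principal (r `` {k}) \<le> inf (principal (r `` {i})) (principal (r `` {j}))"
    if ij: "i \<in> Field r" "j \<in> Field r" for i j
  proof -
    obtain k where k: "(i, k) \<in> r" "(j, k) \<in> r"
      using assms ij by (auto simp: directed_set_def)
    moreover have "trans r"
      using assms by (auto simp: directed_set_def preorder_on_def)
    ultimately show ?thesis
      by (intro bexI[of _ k]) (auto simp: Field_def dest: transD)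
  qed
  then show ?thesis
    using assms unfolding tail_filter_def
    by (subst eventually_INF_base) (auto simp: directed_set_def eventually_principal Ball_def Bex_def)
qed

definition topological_structure :: "('i, 'v::topological_space) net_structure" where
  "topological_structure v =
     {N. is_net N \<and> (net_val N \<longlongrightarrow> v) (tail_filter (net_order N))}"

definition net_continuous ::
    "('i, 'v) net_structure \<Rightarrow> ('i, 'w) net_structure \<Rightarrow> ('v \<Rightarrow> 'w) \<Rightarrow> bool" where
  "net_continuous \<eta> \<theta> g \<longleftrightarrow> (\<forall>v. \<forall>N\<in>\<eta> v. map_net g N \<in> \<theta> (g v))"

definition continuous_dual :: "('i, 'v::real_vector) net_structure \<Rightarrow> ('v \<Rightarrow> real) set" where
  "continuous_dual \<eta> = {\<psi>. linear \<psi> \<and> net_continuous \<eta> topological_structure \<psi>}"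

definition separates_points :: "('v::real_vector \<Rightarrow> real) set \<Rightarrow> bool" where
  "separates_points L \<longleftrightarrow> (\<Inter>\<psi>\<in>L. {x. \<psi> x = 0}) = {0}"

text \<open>
  The index type \<open>'j\<close> of the weak structure is independent of that of \<open>\<eta>\<close>, which enters only
  through its continuous dual.
\<close>

definition weak_structure ::
    "('i, 'v::real_vector) net_structure \<Rightarrow> ('j, 'v) net_structure" where
  "weak_structure \<eta> v =
     {N. is_net N \<and> (\<forall>\<psi>\<in>continuous_dual \<eta>. map_net \<psi> N \<in> topological_structure (\<psi> v))}"

lemma quasi_equivalent_canonical_net:
  fixes N :: "('i, 'v) net"
  assumes "is_net N"
  obtains M :: "('v set \<times> 'v, 'v) net"
  where "is_net M" "quasi_subnet M N" "quasi_subnet N M"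
proof -
  define F where "F = Field (net_order N)"
  define D where "D = {(net_tail N i, x) | i x. i \<in> F \<and> x \<in> net_tail N i}"
  define r where "r = {(p, q). p \<in> D \<and> q \<in> D \<and> fst q \<subseteq> fst p}"
  have refl: "(i, i) \<in> net_order N" if "i \<in> F" for i
    using assms that by (auto simp: is_net_def directed_set_def preorder_on_def refl_on_def F_def)
  have tr: "trans (net_order N)"
    using assms by (auto simp: is_net_def directed_set_def preorder_on_def)
  have mono: "net_tail N j \<subseteq> net_tail N i" if "(i, j) \<in> net_order N" for i j
    using that tr by (auto simp: net_tail_def dest: transD)
  have inF: "i \<in> F \<and> j \<in> F" if "(i, j) \<in> net_order N" for i j
    using that by (auto simp: F_def Field_def)
  have self: "net_val N i \<in> net_tail N i" if "i \<in> F" for i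
    using refl[OF that] by (auto simp: net_tail_def)
  have canon: "(net_tail N i, net_val N i) \<in> D" if "i \<in> F" for i
    using that self by (auto simp: D_def)
  have Fr: "Field r = D"
    by (auto simp: r_def Field_def)
  have "\<exists>k. (p, k) \<in> r \<and> (q, k) \<in> r" if pq: "p \<in> D" "q \<in> D" for p q
  proof -
    obtain i j where ij: "i \<in> F" "j \<in> F" "fst p = net_tail N i" "fst q = net_tail N j"
      using pq by (auto simp: D_def)
    then obtain k where k: "(i, k) \<in> net_order N" "(j, k) \<in> net_order N"
      using assms unfolding is_net_def directed_set_def F_def by blast
    then have "(p, (net_tail N k, net_val N k)) \<in> r \<and> (q, (net_tail N k, net_val N k)) \<in> r"
      using pq ij mono canon inF by (auto simp: r_def)
    then show ?thesis by blast
  qed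
  moreover have "D \<noteq> {}"
    using assms canon by (auto simp: is_net_def directed_set_def F_def)
  moreover have "preorder_on D r"
    by (auto simp: preorder_on_def r_def refl_on_def trans_def)
  ultimately have "is_net (Net r snd)"
    by (auto simp: is_net_def directed_set_def Fr)
  moreover have tail: "net_tail (Net r snd) (net_tail N i, x) = net_tail N i"
    if "i \<in> F" "x \<in> net_tail N i" for i x
  proof
    show "net_tail (Net r snd) (net_tail N i, x) \<subseteq> net_tail N i"
      by (auto simp: net_tail_def r_def D_def)
    show "net_tail N i \<subseteq> net_tail (Net r snd) (net_tail N i, x)"
    proof
      fix y assume "y \<in> net_tail N i"
      then have "((net_tail N i, x), (net_tail N i, y)) \<in> r"
        using that by (auto simp: r_def D_def)
      then show "y \<in> net_tail (Net r snd) (net_tail N i, x)"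
        unfolding net_tail_def[of "Net r snd"] by force
    qed
  qed
  moreover have "quasi_subnet (Net r snd) N"
    unfolding quasi_subnet_def
  proof
    fix i assume "i \<in> Field (net_order N)"
    then show "\<exists>j\<in>Field (net_order (Net r snd)). net_tail (Net r snd) j \<subseteq> net_tail N i"
      using canon[of i] tail[OF _ self, of i]
      by (intro bexI[of _ "(net_tail N i, net_val N i)"]) (auto simp: Fr F_def)
  qed
  moreover have "quasi_subnet N (Net r snd)"
    unfolding quasi_subnet_def
  proof
    fix p assume "p \<in> Field (net_order (Net r snd))"
    then obtain i x where "i \<in> F" "x \<in> net_tail N i" "p = (net_tail N i, x)"
      by (auto simp: Fr D_def)
    then show "\<exists>j\<in>Field (net_order N). net_tail N j \<subseteq> net_tail (Net r snd) p"
      using tail by (auto simp: F_def)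
  qed
  ultimately show ?thesis using that by blast
qed

definition weakly_measurable ::
    "('i, 'v::real_vector) net_structure \<Rightarrow> 'a measure \<Rightarrow> ('a \<Rightarrow> 'v) \<Rightarrow> bool" where
  "weakly_measurable \<eta> M f \<longleftrightarrow> (\<forall>\<psi>\<in>continuous_dual \<eta>. \<psi> \<circ> f \<in> borel_measurable M)"

definition scalarly_integrable ::
    "('i, 'v::real_vector) net_structure \<Rightarrow> 'a measure \<Rightarrow> ('a \<Rightarrow> 'v) \<Rightarrow> bool" where
  "scalarly_integrable \<eta> M f \<longleftrightarrow>
     weakly_measurable \<eta> M f \<and> (\<forall>\<psi>\<in>continuous_dual \<eta>. integrable M (\<psi> \<circ> f))"

definition has_pettis_integral ::
    "('i, 'v::real_vector) net_structure \<Rightarrow> 'a measure \<Rightarrow> ('a \<Rightarrow> 'v) \<Rightarrow> 'a set \<Rightarrow> 'v \<Rightarrow> bool" where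
  "has_pettis_integral \<eta> M f A x \<longleftrightarrow> scalarly_integrable \<eta> M f \<and> A \<in> sets M \<and>
     (\<forall>\<psi>\<in>continuous_dual \<eta>. \<psi> x = (LINT \<omega>:A|M. \<psi> (f \<omega>)))"

definition pettis_integrable_on ::
    "('i, 'v::real_vector) net_structure \<Rightarrow> 'a measure \<Rightarrow> ('a \<Rightarrow> 'v) \<Rightarrow> 'a set \<Rightarrow> bool" where
  "pettis_integrable_on \<eta> M f A \<longleftrightarrow> (\<exists>x. has_pettis_integral \<eta> M f A x)"

definition pettis_integrable ::
    "('i, 'v::real_vector) net_structure \<Rightarrow> 'a measure \<Rightarrow> ('a \<Rightarrow> 'v) \<Rightarrow> bool" where
  "pettis_integrable \<eta> M f \<longleftrightarrow> (\<forall>A\<in>sets M. pettis_integrable_on \<eta> M f A)"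

definition pettis_integral ::
    "('i, 'v::real_vector) net_structure \<Rightarrow> 'a measure \<Rightarrow> ('a \<Rightarrow> 'v) \<Rightarrow> 'a set \<Rightarrow> 'v" where
  "pettis_integral \<eta> M f A = (THE x. has_pettis_integral \<eta> M f A x)"

text \<open>
  The entry at \<open>\<gamma>\<close> of the integration net \<open>P A\<close> is a triple \<open>(I\<^sub>\<gamma>, \<sigma>\<^sub>\<gamma>, \<tau>\<^sub>\<gamma>)\<close>: a finite index set
  and, indexed by it, a family of measurable sets and a family of points.  The sets need not be
  contained in \<open>A\<close>, disjoint, or covering.
\<close>

type_synonym ('k, 'a) tagged_family = "'k set \<times> ('k \<Rightarrow> 'a set) \<times> ('k \<Rightarrow> 'a)"

type_synonym ('g, 'k, 'a) integration_nets = "'a set \<Rightarrow> ('g, ('k, 'a) tagged_family) net"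

definition tagged_family_in :: "'a measure \<Rightarrow> ('k, 'a) tagged_family \<Rightarrow> bool" where
  "tagged_family_in M = (\<lambda>(I, \<sigma>, \<tau>). finite I \<and> (\<forall>i\<in>I. \<sigma> i \<in> sets M \<and> \<tau> i \<in> space M))"

definition integration_nets_for :: "'a measure \<Rightarrow> ('g, 'k, 'a) integration_nets \<Rightarrow> bool" where
  "integration_nets_for M P \<longleftrightarrow> (\<forall>A\<in>sets M. is_net (P A) \<and>
     (\<forall>\<gamma>\<in>Field (net_order (P A)). tagged_family_in M (net_val (P A) \<gamma>)))"

definition riemann_sum ::
    "'a measure \<Rightarrow> ('a \<Rightarrow> 'v::real_vector) \<Rightarrow> ('k, 'a) tagged_family \<Rightarrow> 'v" where
  "riemann_sum M h = (\<lambda>(I, \<sigma>, \<tau>). \<Sum>i\<in>I. measure M (\<sigma> i) *\<^sub>R h (\<tau> i))"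

text \<open>\<open>\<theta>\<close> is the structure on the codomain in which the limit of the Riemann sums is taken.\<close>

definition has_net_riemann_integral ::
    "('g, 'v::real_vector) net_structure \<Rightarrow> ('g, 'k, 'a) integration_nets \<Rightarrow> 'a measure
      \<Rightarrow> ('a \<Rightarrow> 'v) \<Rightarrow> 'a set \<Rightarrow> 'v \<Rightarrow> bool" where
  "has_net_riemann_integral \<theta> P M h A v \<longleftrightarrow> map_net (riemann_sum M h) (P A) \<in> \<theta> v"

definition net_riemann_integrable_on ::
    "('g, 'v::real_vector) net_structure \<Rightarrow> ('g, 'k, 'a) integration_nets \<Rightarrow> 'a measure
      \<Rightarrow> ('a \<Rightarrow> 'v) \<Rightarrow> 'a set \<Rightarrow> bool" where
  "net_riemann_integrable_on \<theta> P M h A \<longleftrightarrow> (\<exists>v. has_net_riemann_integral \<theta> P M h A v)"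

definition net_riemann_integrable ::
    "('g, 'v::real_vector) net_structure \<Rightarrow> ('g, 'k, 'a) integration_nets \<Rightarrow> 'a measure
      \<Rightarrow> ('a \<Rightarrow> 'v) \<Rightarrow> bool" where
  "net_riemann_integrable \<theta> P M h \<longleftrightarrow> (\<forall>A\<in>sets M. net_riemann_integrable_on \<theta> P M h A)"

definition net_riemann_integral ::
    "('g, 'v::real_vector) net_structure \<Rightarrow> ('g, 'k, 'a) integration_nets \<Rightarrow> 'a measure
      \<Rightarrow> ('a \<Rightarrow> 'v) \<Rightarrow> 'a set \<Rightarrow> 'v" where
  "net_riemann_integral \<theta> P M h A = (THE v. has_net_riemann_integral \<theta> P M h A v)"

end

theory Submission
  imports Defs
begin

text \<open>
  Convergence in the weak structure is tested by the functionals \<open>\<psi>\<close> of the continuous dual, and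
  a linear \<open>\<psi>\<close> carries each Riemann sum of \<open>f\<close> to the corresponding Riemann sum of
  \<open>\<psi> \<circ> f\<close>.  Hence \<open>x\<close> is the net Riemann integral of \<open>f\<close> on \<open>A\<close> exactly when, for every
  \<open>\<psi>\<close>, the number \<open>\<psi> x\<close> is the net Riemann integral of the real function \<open>\<psi> \<circ> f\<close> on \<open>A\<close>.
  Scalar integrability makes \<open>\<psi> \<circ> f\<close> Lebesgue integrable, so that integral exists and is the
  Lebesgue integral; limits of real nets being unique, the condition on \<open>x\<close> becomes
  \<open>\<psi> x = \<integral>\<^sub>A \<psi> \<circ> f d\<mu>\<close> for every \<open>\<psi>\<close>, which is the definition of the Pettis integral.

  Having a Pettis integral and having a weak net Riemann integral are therefore the same relation
  between a set \<open>A\<close> and a vector \<open>x\<close> (lemma \<open>has_net_riemann_integral_weak_iff_pettis\<close>).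
  All three assertions are read off from this: the two notions of integrability agree set by set,
  and the two integrals, each described as the vector in its relation to \<open>A\<close>, have the same
  description.
\<close>

lemma tail_filter_neq_bot:
  assumes "directed_set r"
  shows "tail_filter r \<noteq> bot"
proof
  assume "tail_filter r = bot"
  then have "eventually (\<lambda>_. False) (tail_filter r)"
    by simp
  then obtain i where i: "i \<in> Field r" "\<forall>j. (i, j) \<notin> r"
    using eventually_tail_filter[OF assms, of "\<lambda>_. False"] by auto
  moreover have "(i, i) \<in> r"
    using assms i(1) by (auto simp: directed_set_def preorder_on_def refl_on_def)
  ultimately show False
    by blast
qed

lemma topological_structure_unique_limit:
  fixes u v :: "'v::t2_space"
  assumes "N \<in> topological_structure u" "N \<in> topological_structure v"
  shows "u = v"
  using assms tail_filter_neq_bot[of "net_order N"]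
  by (auto simp: topological_structure_def is_net_def intro: tendsto_unique)

lemma has_net_riemann_integral_iff_eq_integral:
  fixes g :: "'a \<Rightarrow> 'v::{real_vector, t2_space}"
  assumes "net_riemann_integrable_on topological_structure P M g A"
  shows "has_net_riemann_integral topological_structure P M g A v \<longleftrightarrow>
    v = net_riemann_integral topological_structure P M g A"
proof -
  have unique: "\<exists>!v. has_net_riemann_integral topological_structure P M g A v"
    using assms topological_structure_unique_limit
    unfolding net_riemann_integrable_on_def has_net_riemann_integral_def by blast
  show ?thesis
    using theI'[OF unique] unique unfolding net_riemann_integral_def by blast
qed

lemma linear_riemann_sum:
  assumes "linear \<psi>"
  shows "\<psi> \<circ> riemann_sum M f = riemann_sum M (\<psi> \<circ> f)"
  by (auto simp: fun_eq_iff riemann_sum_def linear_sum[OF assms] linear_scale[OF assms])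

text \<open>
  The index set of the Riemann sums does not change when a functional is applied to them, so weak
  convergence of the sums splits into convergence of the scalar sums, one functional at a time.
\<close>

lemma has_net_riemann_integral_weak_iff:
  assumes "is_net (P A)"
  shows "has_net_riemann_integral (weak_structure \<eta>) P M f A x \<longleftrightarrow>
    (\<forall>\<psi>\<in>continuous_dual \<eta>.
      has_net_riemann_integral topological_structure P M (\<psi> \<circ> f) A (\<psi> x))"
proof -
  have "map_net \<psi> (map_net (riemann_sum M f) (P A)) = map_net (riemann_sum M (\<psi> \<circ> f)) (P A)"
    if "\<psi> \<in> continuous_dual \<eta>" for \<psi>
    using that by (simp add: net.map_comp continuous_dual_def linear_riemann_sum)
  moreover have "is_net (map_net (riemann_sum M f) (P A))"
    using assms by (simp add: is_net_def net.map_sel)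
  ultimately show ?thesis
    by (simp add: has_net_riemann_integral_def weak_structure_def)
qed

text \<open>
  Both relations prescribe the scalars \<open>\<psi> x\<close>, one as net Riemann and the other as Lebesgue
  integrals of \<open>\<psi> \<circ> f\<close>.  So it is enough that these two scalar integrals agree for the functions
  \<open>\<psi> \<circ> f\<close> on the set \<open>A\<close> under consideration.
\<close>

lemma has_net_riemann_integral_weak_iff_pettis:
  assumes "is_net (P A)" "A \<in> sets M" "scalarly_integrable \<eta> M f"
    and scalar_integrable: "\<And>\<psi>. \<psi> \<in> continuous_dual \<eta> \<Longrightarrow>
      net_riemann_integrable_on topological_structure P M (\<psi> \<circ> f) A"
    and scalar_integral: "\<And>\<psi>. \<psi> \<in> continuous_dual \<eta> \<Longrightarrow>
      net_riemann_integral topological_structure P M (\<psi> \<circ> f) A = (LINT \<omega>:A|M. \<psi> (f \<omega>))"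
  shows "has_net_riemann_integral (weak_structure \<eta>) P M f A x \<longleftrightarrow>
    has_pettis_integral \<eta> M f A x"
  using assms(2,3)
  by (simp add: has_net_riemann_integral_weak_iff[of P A, OF assms(1)] has_pettis_integral_def
      has_net_riemann_integral_iff_eq_integral scalar_integrable scalar_integral)

theorem theorem2p5:
  fixes \<eta> :: "('i, 'x::real_vector) net_structure"
    and M :: "'a measure"
    and f :: "'a \<Rightarrow> 'x"
    and P :: "('g, 'k, 'a) integration_nets"
  assumes "complete_measure M" and "finite_measure M"
    and "net_vector_space \<eta>"
    and "continuous_dual \<eta> \<noteq> {}" and "separates_points (continuous_dual \<eta>)"
    and "scalarly_integrable \<eta> M f"
    and "integration_nets_for M P"
    and "\<And>g :: 'a \<Rightarrow> real. g \<in> borel_measurable M \<Longrightarrow> integrable M g \<Longrightarrow>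
           net_riemann_integrable topological_structure P M g \<and>
           (\<forall>A\<in>sets M. net_riemann_integral topological_structure P M g A = (LINT \<omega>:A|M. g \<omega>))"
    and "\<And>g :: 'a \<Rightarrow> real. g \<in> borel_measurable M \<Longrightarrow>
           net_riemann_integrable topological_structure P M g \<Longrightarrow>
           integrable M g \<and>
           (\<forall>A\<in>sets M. (LINT \<omega>:A|M. g \<omega>) = net_riemann_integral topological_structure P M g A)"
  shows "(pettis_integrable \<eta> M f \<longleftrightarrow>
           (\<forall>A\<in>sets M. \<exists>x. has_net_riemann_integral (weak_structure \<eta>) P M f A x)) \<and>
         ((\<forall>A\<in>sets M. pettis_integrable_on \<eta> M f A) \<longleftrightarrow>
           net_riemann_integrable (weak_structure \<eta>) P M f) \<and>
         (\<forall>A\<in>sets M. pettis_integrable_on \<eta> M f A \<or>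
             net_riemann_integrable_on (weak_structure \<eta>) P M f A \<longrightarrow>
           pettis_integral \<eta> M f A = net_riemann_integral (weak_structure \<eta>) P M f A)"
proof -
  have same_relation: "has_net_riemann_integral (weak_structure \<eta>) P M f A = has_pettis_integral \<eta> M f A"
    if A: "A \<in> sets M" for A
  proof (intro ext has_net_riemann_integral_weak_iff_pettis)
    show "is_net (P A)"
      using assms(7) A by (simp add: integration_nets_for_def)
    fix \<psi> assume "\<psi> \<in> continuous_dual \<eta>"
    then have "\<psi> \<circ> f \<in> borel_measurable M" "integrable M (\<psi> \<circ> f)"
      using assms(6) by (auto simp: scalarly_integrable_def weakly_measurable_def)
    note scalar = assms(8)[OF this]
    show "net_riemann_integrable_on topological_structure P M (\<psi> \<circ> f) A"
      using scalar A by (simp add: net_riemann_integrable_def)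
    show "net_riemann_integral topological_structure P M (\<psi> \<circ> f) A = (LINT \<omega>:A|M. \<psi> (f \<omega>))"
      using scalar A by simp
  qed (use A assms(6) in simp_all)
  show ?thesis
    by (simp add: same_relation pettis_integrable_def pettis_integrable_on_def
        net_riemann_integrable_def net_riemann_integrable_on_def
        pettis_integral_def net_riemann_integral_def)
qed

end
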